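(* Let $n\geq 2$, let $m\in(0,+\infty)$, and let $(\mathbb{R}^{n},g)$ be the standard pseudo-Euclidean space with Cartesian coordinates $x=(x_1,\dots,x_n)$ and $g_{ij}=\delta_{ij}\varepsilon_i$, $\varepsilon_i=\pm1$. Let $$\xi=\sum_{k=1}^{n-1}\varepsilon_kx_k^2,$$ and let $h(\xi),\varphi(\xi),\lambda(\xi)$ be smooth functions such that, with $\bar g=\frac{1}{\varphi^2(\xi)}g$, $$Ric_{\bar g}-\frac{m}{h}\,Hess_{\bar g}(h)=\lambda\,\bar g .$$ Then $\left(\mathbb{R}^{n},\bar g=\frac{1}{\varphi^2(\xi)}g,h(\xi),\lambda(\xi)\right)$ is a trivial generalized $m$-quasi-Einstein manifold, i.e. either $\varphi$ or $h$ is a constant function.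
   Context: $Ric_{\bar g}$ and $Hess_{\bar g}(h)$ denote the Ricci tensor and the Hessian of $h$ with respect to the metric $\bar g$. The functions $\varphi$ and $h$ are nowhere vanishing, so that $\bar g$ and the equation are defined. The notation $h(\xi)$ means $h\circ\xi$, where $h$ is a real function of one real variable, and similarly for $\varphi(\xi)$ and $\lambda(\xi)$. *)

theory Defs
  imports "HOL-Analysis.Analysis"
begin

text \<open>
  Tensor calculus on \<open>\<real>\<^sup>n\<close> in the global Cartesian chart. A tensor field of type \<open>(0,2)\<close>, in
  particular a pseudo-Riemannian metric, is given by its matrix of components at every point.
\<close>

definition partial :: "'n::finite \<Rightarrow> (real ^ 'n \<Rightarrow> real) \<Rightarrow> real ^ 'n \<Rightarrow> real" where
  "partial i f x = deriv (\<lambda>t. f (x + t *\<^sub>R axis i 1)) 0"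

primrec C_k :: "nat \<Rightarrow> (real ^ 'n::finite \<Rightarrow> real) \<Rightarrow> bool" where
  "C_k 0 f \<longleftrightarrow> continuous_on UNIV f"
| "C_k (Suc k) f \<longleftrightarrow> f differentiable_on UNIV \<and> (\<forall>i. C_k k (partial i f))"

definition smooth :: "(real ^ 'n::finite \<Rightarrow> real) \<Rightarrow> bool" where
  "smooth f \<longleftrightarrow> (\<forall>k. C_k k f)"

type_synonym 'n tensor2 = "real ^ 'n \<Rightarrow> real ^ 'n ^ 'n"

text \<open>\<open>christoffel G k i j\<close> is \<open>\<Gamma>\<^sup>k\<^sub>i\<^sub>j\<close>, the \<open>k\<close>-th component of \<open>\<nabla>\<^sub>i \<partial>\<^sub>j\<close>.\<close>

definition christoffel ::
  "'n::finite tensor2 \<Rightarrow> 'n \<Rightarrow> 'n \<Rightarrow> 'n \<Rightarrow> real ^ 'n \<Rightarrow> real" where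
  "christoffel G k i j x =
     (1 / 2) * (\<Sum>l\<in>UNIV. matrix_inv (G x) $ k $ l *
        (partial i (\<lambda>y. G y $ j $ l) x + partial j (\<lambda>y. G y $ i $ l) x
           - partial l (\<lambda>y. G y $ i $ j) x))"

text \<open>
  \<open>riemann G l k i j\<close> is the \<open>l\<close>-th component of \<open>R(\<partial>\<^sub>i, \<partial>\<^sub>j) \<partial>\<^sub>k\<close>, where
  \<open>R(X, Y) Z = \<nabla>\<^sub>X \<nabla>\<^sub>Y Z - \<nabla>\<^sub>Y \<nabla>\<^sub>X Z - \<nabla>\<^bsub>[X,Y]\<^esub> Z\<close>; the Ricci tensor is
  \<open>Ric(Y, Z) = tr (X \<mapsto> R(X, Y) Z)\<close>, so that round spheres have positive Ricci curvature.
\<close>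

definition riemann ::
  "'n::finite tensor2 \<Rightarrow> 'n \<Rightarrow> 'n \<Rightarrow> 'n \<Rightarrow> 'n \<Rightarrow> real ^ 'n \<Rightarrow> real" where
  "riemann G l k i j x =
     partial i (christoffel G l j k) x - partial j (christoffel G l i k) x
       + (\<Sum>p\<in>UNIV. christoffel G l i p x * christoffel G p j k x
                    - christoffel G l j p x * christoffel G p i k x)"

definition ricci :: "'n::finite tensor2 \<Rightarrow> 'n tensor2" where
  "ricci G x = (\<chi> j k. \<Sum>i\<in>UNIV. riemann G i k i j x)"

definition hessian :: "'n::finite tensor2 \<Rightarrow> (real ^ 'n \<Rightarrow> real) \<Rightarrow> 'n tensor2" where
  "hessian G f x =
     (\<chi> i j. partial i (partial j f) x - (\<Sum>k\<in>UNIV. christoffel G k i j x * partial k f x))"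

definition pseudo_euclidean_metric :: "('n::finite \<Rightarrow> real) \<Rightarrow> 'n tensor2" where
  "pseudo_euclidean_metric \<epsilon> x = (\<chi> i j. if i = j then \<epsilon> i else 0)"

definition conformal_metric ::
  "(real ^ 'n::finite \<Rightarrow> real) \<Rightarrow> 'n tensor2 \<Rightarrow> 'n tensor2" where
  "conformal_metric f G x = (1 / (f x)\<^sup>2) *\<^sub>R G x"

text \<open>
  The index type is linearly ordered, so that \<open>Max UNIV\<close> is the last of the \<open>n\<close> coordinate
  indices and the sum below runs over the first \<open>n - 1\<close> of them.
\<close>

definition partial_square_sum ::
  "('n::{finite,linorder} \<Rightarrow> real) \<Rightarrow> real ^ ('n::{finite,linorder}) \<Rightarrow> real" where
  "partial_square_sum \<epsilon> x = (\<Sum>k | k < Max UNIV. \<epsilon> k * (x $ k)\<^sup>2)"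

end

theory Submission
  imports Defs
begin

text \<open>
  Write \<open>F = h \<circ> \<xi>\<close> and \<open>P = \<phi> \<circ> \<xi>\<close>. Modulo multiples of the metric, the diagonal part of the
  equation reads \<open>(n - 2) P\<^sub>j\<^sub>j / P = (m / F) (F\<^sub>j\<^sub>j + 2 P\<^sub>j F\<^sub>j / P)\<close>, and since nothing depends on
  the last coordinate, the multiple in question is zero. Restrict this to the axis of a
  coordinate \<open>x\<^sub>i\<close>, \<open>i < n\<close>, where \<open>F\<close> and \<open>P\<close> become even functions \<open>f\<close> and \<open>p\<close> of \<open>t = x\<^sub>i\<close>. The
  choice \<open>j = i\<close> gives \<open>(n - 2) f p'' = m (p f'' + 2 p' f')\<close>. For \<open>n = 2\<close> this says that \<open>p\<^sup>2 f'\<close> is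
  constant, and it vanishes at \<open>0\<close>. For \<open>n \<ge> 3\<close> a further choice \<open>j \<noteq> i\<close>, \<open>j < n\<close> gives
  \<open>(n - 2) f p' = m p f'\<close>, because \<open>F\<^sub>j\<^sub>j = \<plusminus>f' / t\<close> and \<open>F\<^sub>j = 0\<close> on the axis; differentiating and
  subtracting yields \<open>(n - 2 + m) p' f' = 0\<close>, hence \<open>f' = 0\<close>. So in all cases it is \<open>h\<close> that is
  constant.
\<close>

section \<open>Partial derivatives along coordinate lines\<close>

text \<open>\<open>partial\<close> is a value of \<open>deriv\<close> at parameter 0 only.
  Differentiability turns it into a genuine derivative at every parameter \<open>s\<close> of the
  line, as the differential equations on the axes require.\<close>

lemma has_real_derivative_partial:
  fixes f :: "real ^ 'n::finite \<Rightarrow> real"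
  assumes "f differentiable_on UNIV"
  shows "((\<lambda>t. f (x + t *\<^sub>R axis i 1)) has_real_derivative
           partial i f (x + s *\<^sub>R axis i 1)) (at s)"
proof -
  have "f differentiable (at (x + s *\<^sub>R axis i 1))"
    using assms by (simp add: differentiable_on_def)
  then obtain D where D: "(f has_derivative D) (at (x + s *\<^sub>R axis i 1))"
    by (auto simp: differentiable_def)
  have lin: "D (t *\<^sub>R axis i 1) = t * D (axis i 1)" for t
    using has_derivative_bounded_linear[OF D] by (simp add: linear_simps)
  have "((\<lambda>t. f (x + t *\<^sub>R axis i 1)) has_derivative (\<lambda>t. D (t *\<^sub>R axis i 1))) (at s)"
    by (rule has_derivative_compose[where f = "\<lambda>t. x + t *\<^sub>R axis i 1", OF _ D])
       (auto intro!: derivative_eq_intros)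
  then have *: "((\<lambda>t. f (x + t *\<^sub>R axis i 1)) has_real_derivative D (axis i 1)) (at s)"
    by (simp add: has_field_derivative_def lin mult_commute_abs)
  have "((\<lambda>t. f (x + t *\<^sub>R axis i 1)) has_real_derivative D (axis i 1)) (at (0 + s))"
    using * by simp
  then have "((\<lambda>t. f (x + (t + s) *\<^sub>R axis i 1)) has_real_derivative D (axis i 1)) (at 0)"
    by (subst (asm) DERIV_shift)
  then have "partial i f (x + s *\<^sub>R axis i 1) = D (axis i 1)"
    unfolding partial_def by (intro DERIV_imp_deriv) (simp add: algebra_simps)
  with * show ?thesis by simp
qed

lemma has_real_derivative_partial_0:
  fixes f :: "real ^ 'n::finite \<Rightarrow> real"
  assumes "f differentiable_on UNIV"
  shows "((\<lambda>t. f (x + t *\<^sub>R axis i 1)) has_real_derivative partial i f x) (at 0)"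
  using has_real_derivative_partial[OF assms, of x i 0] by simp

lemma partial_eqI:
  "((\<lambda>t. f (x + t *\<^sub>R axis i 1)) has_real_derivative D) (at 0) \<Longrightarrow> partial i f x = D"
  by (simp add: partial_def DERIV_imp_deriv)

lemma smooth_differentiable:
  assumes "smooth f"
  shows "f differentiable_on UNIV" and "partial i f differentiable_on UNIV"
proof -
  have "C_k (Suc (Suc 0)) f"
    using assms unfolding smooth_def by blast
  then show "f differentiable_on UNIV" "partial i f differentiable_on UNIV"
    by simp_all
qed

section \<open>Diagonal curvature and Hessian of a conformally flat metric\<close>

context
  fixes \<epsilon> :: "'n::finite \<Rightarrow> real" and P :: "real ^ 'n \<Rightarrow> real"
  assumes sign: "\<And>i. \<epsilon> i = 1 \<or> \<epsilon> i = -1"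
    and P_nz: "\<And>x. P x \<noteq> 0"
    and P_diff: "P differentiable_on UNIV"
begin

private abbreviation (input) "g_conf \<equiv> conformal_metric P (pseudo_euclidean_metric \<epsilon>)"
text \<open>The logarithmic derivative of \<open>P\<close>; the Christoffel symbols are linear in
  it.\<close>

private abbreviation (input) "u k x \<equiv> partial k P x / P x"

lemma sign_sq: "\<epsilon> i * \<epsilon> i = 1"
  using sign[of i] by auto

lemma sign_cancel: "\<epsilon> i * (\<epsilon> i * a) = a"
  using sign_sq[of i] by (simp flip: mult.assoc)

lemma conformal_metric_component: "g_conf x $ i $ j = (if i = j then \<epsilon> i / (P x)\<^sup>2 else 0)"
  by (simp add: conformal_metric_def pseudo_euclidean_metric_def)

lemma matrix_inv_conformal_metric:
  "matrix_inv (g_conf x) $ i $ j = (if i = j then \<epsilon> i * (P x)\<^sup>2 else 0)"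
proof -
  define B :: "real ^ 'n ^ 'n" where "B = (\<chi> i j. if i = j then \<epsilon> i * (P x)\<^sup>2 else 0)"
  have "g_conf x ** B = mat 1"
    using P_nz[of x] sign_sq
    by (auto simp: matrix_matrix_mult_def mat_def vec_eq_iff B_def conformal_metric_component
        if_distrib[of "\<lambda>a. a * _"] if_distrib[of "(*) _"] cong: if_cong)
  moreover from this have "B ** g_conf x = mat 1"
    by (simp add: matrix_left_right_inverse)
  ultimately have inv: "g_conf x ** B = mat 1 \<and> B ** g_conf x = mat 1" ..
  \<comment> \<open>\<open>matrix_inv\<close> is a choice among two-sided inverses, so the witness
    \<open>B\<close> is needed first; uniqueness then identifies the two.\<close>
  then have "g_conf x ** matrix_inv (g_conf x) = mat 1"
    unfolding matrix_inv_def by (rule someI2[of _ B]) simp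
  then have "matrix_inv (g_conf x) = B"
    by (metis inv matrix_mul_assoc matrix_mul_lid matrix_mul_rid)
  then show ?thesis by (simp add: B_def)
qed

lemma partial_conformal_metric:
  "partial i (\<lambda>y. g_conf y $ j $ l) x = (if j = l then - 2 * \<epsilon> j * u i x / (P x)\<^sup>2 else 0)"
proof (cases "j = l")
  case True
  show ?thesis
    unfolding conformal_metric_component using True P_nz
    by (intro partial_eqI)
       (auto intro!: derivative_eq_intros has_real_derivative_partial_0[OF P_diff]
         simp: field_simps power2_eq_square)
next
  case False
  then show ?thesis
    unfolding conformal_metric_component by (intro partial_eqI) auto
qed

text \<open>The inverse metric is diagonal, so only \<open>l = k\<close> survives, and its factor
  \<open>(P x)^2\<close> cancels the denominator of the metric derivatives.\<close>

lemma christoffel_conformal_metric: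
  "christoffel g_conf k i j x =
     (if i = j then \<epsilon> i * \<epsilon> k * u k x else 0)
       - (if j = k then u i x else 0) - (if i = k then u j x else 0)"
proof -
  have "christoffel g_conf k i j x = (1 / 2) * (\<epsilon> k * (P x)\<^sup>2) *
      (partial i (\<lambda>y. g_conf y $ j $ k) x + partial j (\<lambda>y. g_conf y $ i $ k) x
           - partial k (\<lambda>y. g_conf y $ i $ j) x)"
    unfolding christoffel_def matrix_inv_conformal_metric
    by (simp add: if_distrib[of "\<lambda>a. a * _"] cong: if_cong)
  also have "\<dots> = (if i = j then \<epsilon> i * \<epsilon> k * u k x else 0)
       - (if j = k then (\<epsilon> k * \<epsilon> k) * u i x else 0) - (if i = k then (\<epsilon> k * \<epsilon> k) * u j x else 0)"
    unfolding partial_conformal_metric using P_nz[of x]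
    by (auto simp: field_simps)
  finally show ?thesis by (simp add: sign_sq cong: if_cong)
qed

lemma hessian_conformal_metric_diagonal:
  "hessian g_conf f x $ j $ j = partial j (partial j f) x + 2 * u j x * partial j f x
     - \<epsilon> j * (\<Sum>k\<in>UNIV. \<epsilon> k * u k x * partial k f x)"
proof -
  have "(\<Sum>k\<in>UNIV. christoffel g_conf k j j x * partial k f x)
      = (\<Sum>k\<in>UNIV. \<epsilon> j * (\<epsilon> k * u k x * partial k f x)
           - (if j = k then 2 * u j x * partial j f x else 0))"
    by (rule sum.cong) (auto simp: christoffel_conformal_metric algebra_simps)
  also have "\<dots> = \<epsilon> j * (\<Sum>k\<in>UNIV. \<epsilon> k * u k x * partial k f x) - 2 * u j x * partial j f x"
    by (simp add: sum_subtractf sum_distrib_left)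
  finally show ?thesis by (simp add: hessian_def)
qed

context
  assumes P_diff2: "\<And>i. partial i P differentiable_on UNIV"
begin

private abbreviation (input) "U k x \<equiv> partial k (partial k P) x / P x - (u k x)\<^sup>2"

lemma has_derivative_u:
  "((\<lambda>t. u k (x + t *\<^sub>R axis k 1)) has_real_derivative U k x) (at 0)"
  using P_nz
  by (auto intro!: derivative_eq_intros has_real_derivative_partial_0[OF P_diff]
        has_real_derivative_partial_0[OF P_diff2] simp: field_simps power2_eq_square)

text \<open>For \<open>i = j\<close> the first two terms of the symbol cancel, so it is
  \<open>- u j\<close> for each single \<open>i\<close>, without summation.\<close>

lemma partial_christoffel_trace:
  "partial j (christoffel g_conf i i j) x = - U j x"
proof (rule partial_eqI)
  have "christoffel g_conf i i j = (\<lambda>y. - u j y)"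
    by (rule ext) (auto simp: christoffel_conformal_metric sign_sq)
  then show "((\<lambda>t. christoffel g_conf i i j (x + t *\<^sub>R axis j 1)) has_real_derivative - U j x) (at 0)"
    by (simp only:) (intro DERIV_minus has_derivative_u)
qed

lemma partial_christoffel_diagonal:
  "partial i (christoffel g_conf i j j) x = \<epsilon> j * \<epsilon> i * U i x - (if i = j then 2 * U j x else 0)"
proof (rule partial_eqI)
  have *: "christoffel g_conf i j j = (\<lambda>y. (\<epsilon> j * \<epsilon> i - (if i = j then 2 else 0)) * u i y)"
    by (rule ext) (auto simp: christoffel_conformal_metric algebra_simps)
  show "((\<lambda>t. christoffel g_conf i j j (x + t *\<^sub>R axis i 1)) has_real_derivative
      \<epsilon> j * \<epsilon> i * U i x - (if i = j then 2 * U j x else 0)) (at 0)"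
    unfolding *
    by (rule DERIV_cong[OF DERIV_cmult[OF has_derivative_u]]) (auto simp: algebra_simps)
qed

lemma ricci_conformal_metric_diagonal:
  "ricci g_conf x $ j $ j = (real CARD('n) - 2) * (partial j (partial j P) x / P x)
     + \<epsilon> j * ((\<Sum>i\<in>UNIV. \<epsilon> i * U i x) - (real CARD('n) - 2) * (\<Sum>i\<in>UNIV. \<epsilon> i * (u i x)\<^sup>2))"
proof -
  let ?n = "real CARD('n)" and ?\<Gamma> = "\<lambda>k i j. christoffel g_conf k i j x"
  let ?S = "\<Sum>i\<in>UNIV. \<epsilon> i * (u i x)\<^sup>2"
  have 1: "(\<Sum>i\<in>UNIV. partial i (christoffel g_conf i j j) x)
      = \<epsilon> j * (\<Sum>i\<in>UNIV. \<epsilon> i * U i x) - 2 * U j x"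
    unfolding partial_christoffel_diagonal
    by (simp add: sum_subtractf sum_distrib_left mult.assoc)
  have 2: "(\<Sum>i\<in>UNIV. partial j (christoffel g_conf i i j) x) = - ?n * U j x"
    unfolding partial_christoffel_trace by (simp add: algebra_simps)
  have "(\<Sum>p\<in>UNIV. ?\<Gamma> i i p * ?\<Gamma> p j j)
      = (\<Sum>p\<in>UNIV. (if p = j then 2 * (u j x)\<^sup>2 else 0) - \<epsilon> j * (\<epsilon> p * (u p x)\<^sup>2))" for i
    by (rule sum.cong) (auto simp: christoffel_conformal_metric sign_sq algebra_simps power2_eq_square)
  then have 3: "(\<Sum>i\<in>UNIV. \<Sum>p\<in>UNIV. ?\<Gamma> i i p * ?\<Gamma> p j j) = ?n * (2 * (u j x)\<^sup>2 - \<epsilon> j * ?S)"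
    by (simp add: sum_subtractf sum_distrib_left)
  \<comment> \<open>The product vanishes for pairwise distinct \<open>i\<close>, \<open>j\<close>,
    \<open>p\<close>. The three summands are the cases \<open>p = i\<close>, \<open>i = j\<close>
    and \<open>p = j\<close>; the extra \<open>2 * (u j x)^2\<close> corrects their overlap at
    \<open>i = j = p\<close>.\<close>
  have split: "?\<Gamma> i j p * ?\<Gamma> p i j
      = (if p = i then (u j x)\<^sup>2 else 0)
        + (if i = j then (if p = j then 2 * (u j x)\<^sup>2 else 0) - \<epsilon> j * (\<epsilon> p * (u p x)\<^sup>2) else 0)
        - (if p = j then \<epsilon> j * (\<epsilon> i * (u i x)\<^sup>2) else 0)" for i p
    unfolding christoffel_conformal_metric
    by (auto simp: sign_cancel sign_sq algebra_simps power2_eq_square add_divide_distrib)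
  have "(\<Sum>p\<in>UNIV. ?\<Gamma> i j p * ?\<Gamma> p i j)
      = (u j x)\<^sup>2 + (if i = j then 2 * (u j x)\<^sup>2 - \<epsilon> j * ?S else 0) - \<epsilon> j * (\<epsilon> i * (u i x)\<^sup>2)" for i
    unfolding split by (auto simp: sum_subtractf sum.distrib sum_distrib_left)
  then have 4: "(\<Sum>i\<in>UNIV. \<Sum>p\<in>UNIV. ?\<Gamma> i j p * ?\<Gamma> p i j)
      = (?n + 2) * (u j x)\<^sup>2 - 2 * \<epsilon> j * ?S"
    by (simp add: sum_subtractf sum.distrib flip: sum_distrib_left) (simp add: algebra_simps)
  have "ricci g_conf x $ j $ j = (\<Sum>i\<in>UNIV. partial i (christoffel g_conf i j j) x)
      - (\<Sum>i\<in>UNIV. partial j (christoffel g_conf i i j) x)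
      + ((\<Sum>i\<in>UNIV. \<Sum>p\<in>UNIV. ?\<Gamma> i i p * ?\<Gamma> p j j)
         - (\<Sum>i\<in>UNIV. \<Sum>p\<in>UNIV. ?\<Gamma> i j p * ?\<Gamma> p i j))"
    by (simp add: ricci_def riemann_def sum.distrib sum_subtractf)
  then show ?thesis
    unfolding 1 2 3 4 by (simp add: algebra_simps diff_divide_distrib)
qed

text \<open>Neither function depends on coordinate \<open>n\<close>, so comparison with the
  \<open>n\<close>-th diagonal entry removes \<open>l\<close> and every other term proportional to
  the metric.\<close>

lemma conformal_equation_diagonal:
  assumes eq: "ricci g_conf x - c *\<^sub>R hessian g_conf F x = l *\<^sub>R g_conf x"
    and n: "\<And>y. partial n P y = 0" "\<And>y. partial n F y = 0"
  shows "(real CARD('n) - 2) * (partial j (partial j P) x / P x)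
     = c * (partial j (partial j F) x + 2 * (partial j P x / P x) * partial j F x)"
proof -
  define E where "E j = (real CARD('n) - 2) * (partial j (partial j P) x / P x)
     - c * (partial j (partial j F) x + 2 * u j x * partial j F x)" for j
  \<comment> \<open>All remaining terms are multiples of the metric, with a factor independent of \<open>j\<close>.\<close>
  obtain K where K: "\<And>j. E j = \<epsilon> j * K"
  proof
    fix j
    have "ricci g_conf x $ j $ j - c * hessian g_conf F x $ j $ j = l * (\<epsilon> j / (P x)\<^sup>2)"
      using arg_cong[OF eq, of "\<lambda>A. A $ j $ j"] by (simp add: conformal_metric_component)
    then show "E j = \<epsilon> j * (l / (P x)\<^sup>2
        - ((\<Sum>i\<in>UNIV. \<epsilon> i * U i x) - (real CARD('n) - 2) * (\<Sum>i\<in>UNIV. \<epsilon> i * (u i x)\<^sup>2))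
        - c * (\<Sum>k\<in>UNIV. \<epsilon> k * u k x * partial k F x))"
      unfolding ricci_conformal_metric_diagonal hessian_conformal_metric_diagonal E_def
      by (simp add: algebra_simps)
  qed
  have "partial n (partial n P) x = 0" "partial n (partial n F) x = 0"
    using n by (auto intro!: partial_eqI)
  then have "E n = 0"
    by (simp add: E_def n)
  then have "K = 0"
    using K[of n] sign[of n] by auto
  then show ?thesis
    using K[of j] by (simp add: E_def)
qed

end

end

section \<open>Differential equations on an axis\<close>

text \<open>
  Here \<open>x\<close> is the point with coordinate \<open>t\<close> on another axis, \<open>f\<close> is the restriction of \<open>F\<close> to that
  axis, and \<open>F\<close> is constant on the conics \<open>t\<^sup>2 + \<sigma> s\<^sup>2 = const\<close> in the plane of the two axes.
\<close>

lemma partial_transverse: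
  fixes F :: "real ^ 'n::finite \<Rightarrow> real"
  assumes F: "F differentiable_on UNIV"
    and f: "\<And>r. (f has_real_derivative f1 r) (at r)"
    and f1: "(f1 has_real_derivative f2) (at t)"
    and \<sigma>: "\<sigma> = 1 \<or> \<sigma> = -1" and "t > 0"
    and radial: "\<And>s. \<bar>s\<bar> < t \<Longrightarrow> F (x + s *\<^sub>R axis j 1) = f (sqrt (t\<^sup>2 + \<sigma> * s\<^sup>2))"
  shows "partial j F x = 0" and "partial j (partial j F) x = \<sigma> * (f1 t / t)"
proof -
  let ?r = "\<lambda>s. sqrt (t\<^sup>2 + \<sigma> * s\<^sup>2)"
  \<comment> \<open>For \<open>\<sigma> = -1\<close> the conic is a hyperbola, and
    \<open>\<bar>s\<bar> < t\<close> keeps the radicand positive.\<close>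
  have pos: "t\<^sup>2 + \<sigma> * s\<^sup>2 > 0" if "\<bar>s\<bar> < t" for s
  proof -
    have "s\<^sup>2 < t\<^sup>2"
      using that abs_le_square_iff[of t s] by linarith
    then show ?thesis
      using \<sigma> \<open>t > 0\<close> by (auto simp: add_pos_nonneg)
  qed
  have r': "(?r has_real_derivative \<sigma> * s / ?r s) (at s)" if "\<bar>s\<bar> < t" for s
    using pos[OF that] by (auto intro!: derivative_eq_intros simp: field_simps)
  \<comment> \<open>With the factor \<open>s\<close> pulled out, the derivative at
    \<open>s = 0\<close> is the value of the cofactor there.\<close>
  have first: "partial j F (x + s *\<^sub>R axis j 1) = s * (\<sigma> * f1 (?r s) / ?r s)" if "\<bar>s\<bar> < t" for s
  proof (rule DERIV_unique[OF has_real_derivative_partial[OF F]])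
    have "((\<lambda>s. f (?r s)) has_real_derivative f1 (?r s) * (\<sigma> * s / ?r s)) (at s)"
      using r'[OF that] by (rule DERIV_chain2[OF f])
    moreover have "eventually (\<lambda>s. f (?r s) = F (x + s *\<^sub>R axis j 1)) (nhds s)"
      using eventually_nhds_in_open[of "{-t<..<t}" s] that
      by (auto elim!: eventually_mono simp: radial abs_less_iff)
    ultimately show "((\<lambda>s. F (x + s *\<^sub>R axis j 1)) has_real_derivative
        s * (\<sigma> * f1 (?r s) / ?r s)) (at s)"
      by (subst (asm) DERIV_cong_ev) (auto simp: mult_ac)
  qed
  from first[of 0] \<open>t > 0\<close> show "partial j F x = 0" by simp
  have "(?r has_real_derivative 0) (at 0)"
    using r'[of 0] \<open>t > 0\<close> by simp
  moreover have "(f1 has_real_derivative f2) (at (?r 0))"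
    using f1 \<open>t > 0\<close> by simp
  ultimately have "((\<lambda>s. f1 (?r s)) has_real_derivative 0) (at 0)"
    using DERIV_chain2[of f1 f2 ?r 0 0] by simp
  then have "((\<lambda>s. s * (\<sigma> * f1 (?r s) / ?r s)) has_real_derivative \<sigma> * (f1 t / t)) (at 0)"
    using \<open>(?r has_real_derivative 0) (at 0)\<close> \<open>t > 0\<close>
    by (auto intro!: derivative_eq_intros)
  moreover have "eventually (\<lambda>s. s * (\<sigma> * f1 (?r s) / ?r s) = partial j F (x + s *\<^sub>R axis j 1)) (nhds 0)"
    using eventually_nhds_in_open[of "{-t<..<t}" 0] \<open>t > 0\<close>
    by (auto elim!: eventually_mono simp: first abs_less_iff)
  ultimately show "partial j (partial j F) x = \<sigma> * (f1 t / t)"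
    by (intro partial_eqI) (subst (asm) DERIV_cong_ev, auto)
qed

text \<open>Here \<open>c\<close> is \<open>n - 2\<close>. \<open>transverse\<close> is restricted
  to \<open>c \<noteq> 0\<close> because a second index below the last exists only for
  \<open>n \<ge> 3\<close>, and to \<open>t > 0\<close> because it comes from
  \<open>partial_transverse\<close>.\<close>

lemma warped_ode_constant:
  fixes f f1 f2 p p1 p2 :: "real \<Rightarrow> real"
  assumes f: "\<And>t. (f has_real_derivative f1 t) (at t)" "\<And>t. (f1 has_real_derivative f2 t) (at t)"
    and p: "\<And>t. (p has_real_derivative p1 t) (at t)" "\<And>t. (p1 has_real_derivative p2 t) (at t)"
    and nz: "\<And>t. f t \<noteq> 0" "\<And>t. p t \<noteq> 0"
    and "m > 0" "c \<ge> 0" "f1 0 = 0"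
    and axial: "\<And>t. c * (p2 t / p t) = m / f t * (f2 t + 2 * (p1 t / p t) * f1 t)"
    and transverse: "\<And>t. t > 0 \<Longrightarrow> c \<noteq> 0 \<Longrightarrow> c * (p1 t / t / p t) = m / f t * (f1 t / t)"
    and "t \<ge> 0"
  shows "f t = f 0"
proof -
  have ax: "c * p2 t * f t = m * (p t * f2 t + 2 * p1 t * f1 t)" for t
    using axial[of t] nz by (simp add: field_simps)
  have zero: "f1 t = 0" if "t > 0" for t
  proof (cases "c = 0")
    case True
    have "((\<lambda>t. (p t)\<^sup>2 * f1 t) has_real_derivative p t * (p t * f2 t + 2 * p1 t * f1 t)) (at t)" for t
      by (auto intro!: derivative_eq_intros f p simp: algebra_simps power2_eq_square)
    moreover have "p t * f2 t + 2 * p1 t * f1 t = 0" for t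
      using ax[of t] True \<open>m > 0\<close> by simp
    ultimately have "(p t)\<^sup>2 * f1 t = (p 0)\<^sup>2 * f1 0"
      by (intro DERIV_isconst_all[rule_format]) simp
    then show ?thesis using nz \<open>f1 0 = 0\<close> by simp
  next
    case False
    have tr: "c * p1 t * f t - m * p t * f1 t = 0" if "t > 0" for t
      using transverse[OF that False] that nz by (simp add: field_simps)
    \<comment> \<open>Differentiating \<open>tr\<close> and comparing with \<open>ax\<close> eliminates both second derivatives.\<close>
    have "((\<lambda>t. c * p1 t * f t - m * p t * f1 t) has_real_derivative
        c * (p2 t * f t + p1 t * f1 t) - m * (p1 t * f1 t + p t * f2 t)) (at t)"
      by (auto intro!: derivative_eq_intros f p simp: algebra_simps)
    moreover have "((\<lambda>t. c * p1 t * f t - m * p t * f1 t) has_real_derivative 0) (at t)"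
    proof (subst DERIV_cong_ev[OF refl _ refl])
      show "eventually (\<lambda>t. c * p1 t * f t - m * p t * f1 t = 0) (nhds t)"
        by (rule eventually_mono[OF eventually_nhds_in_open[of "{0<..}" t]])
           (use that tr in auto)
    qed simp
    ultimately have "c * (p2 t * f t + p1 t * f1 t) - m * (p1 t * f1 t + p t * f2 t) = 0"
      by (rule DERIV_unique)
    with ax[of t] have "(c + m) * (p1 t * f1 t) = 0"
      by (simp add: algebra_simps)
    then have "p1 t * f1 t = 0"
      using \<open>c \<ge> 0\<close> \<open>m > 0\<close> by simp
    \<comment> \<open>If \<open>p1 t = 0\<close>, then \<open>tr\<close> reduces to
      \<open>m * p t * f1 t = 0\<close>.\<close>
    then show ?thesis
      using tr[OF that] nz \<open>m > 0\<close> by auto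
  qed
  have "f1 t = 0" if "t \<ge> 0" for t
    using zero[of t] that \<open>f1 0 = 0\<close> by (cases "t = 0") auto
  then have "(f has_real_derivative 0) (at t)" if "t > 0" for t
    using f(1)[of t] that by simp
  moreover have "continuous_on {0..t} f"
    using f(1) by (blast intro: DERIV_isCont continuous_at_imp_continuous_on)
  ultimately show ?thesis
    using DERIV_isconst2[of 0 t f t] \<open>t \<ge> 0\<close> by (cases "t = 0") auto
qed

section \<open>The quadratic form on the coordinate axes\<close>

lemma partial_square_sum_axes:
  assumes "i < Max UNIV" "j < Max UNIV" "i \<noteq> j"
  shows "partial_square_sum \<epsilon> (t *\<^sub>R axis i 1 + s *\<^sub>R axis j 1) = \<epsilon> i * t\<^sup>2 + \<epsilon> j * s\<^sup>2"
proof -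
  have "partial_square_sum \<epsilon> (t *\<^sub>R axis i 1 + s *\<^sub>R axis j 1)
    = (\<Sum>k | k < Max UNIV. (if k = i then \<epsilon> i * t\<^sup>2 else 0) + (if k = j then \<epsilon> j * s\<^sup>2 else 0))"
    unfolding partial_square_sum_def using assms by (intro sum.cong) (auto simp: axis_def)
  then show ?thesis
    using assms by (simp add: sum.distrib)
qed

lemma partial_square_sum_axis:
  assumes "i < Max UNIV"
  shows "partial_square_sum \<epsilon> (t *\<^sub>R axis i 1) = \<epsilon> i * t\<^sup>2"
proof -
  have "partial_square_sum \<epsilon> (t *\<^sub>R axis i 1) = (\<Sum>k | k < Max UNIV. if k = i then \<epsilon> i * t\<^sup>2 else 0)"
    unfolding partial_square_sum_def by (intro sum.cong) (auto simp: axis_def)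
  then show ?thesis
    using assms by simp
qed

lemma partial_Max_partial_square_sum:
  "partial (Max UNIV) (f \<circ> partial_square_sum \<epsilon>) x = 0"
proof (rule partial_eqI)
  have "partial_square_sum \<epsilon> (x + t *\<^sub>R axis (Max UNIV) 1) = partial_square_sum \<epsilon> x" for t
    unfolding partial_square_sum_def by (intro sum.cong) (auto simp: axis_def)
  then show "((\<lambda>t. (f \<circ> partial_square_sum \<epsilon>) (x + t *\<^sub>R axis (Max UNIV) 1))
      has_real_derivative 0) (at 0)"
    by simp
qed

section \<open>Constancy on the axes and transfer to the whole space\<close>

theorem corollary1:
  fixes \<epsilon> :: "'n::{finite,linorder} \<Rightarrow> real"
    and m :: real
    and h \<phi> lam :: "real \<Rightarrow> real"
    and \<xi> :: "real ^ ('n::{finite,linorder}) \<Rightarrow> real"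
    and g_bar :: "real ^ ('n::{finite,linorder}) \<Rightarrow> real ^ ('n::{finite,linorder}) ^ ('n::{finite,linorder})"
  assumes "CARD('n) \<ge> 2"
    and "m > 0"
    and "\<And>i. \<epsilon> i = 1 \<or> \<epsilon> i = -1"
  defines "\<xi> \<equiv> partial_square_sum \<epsilon>"
  assumes "smooth (h \<circ> \<xi>)" and "smooth (\<phi> \<circ> \<xi>)" and "smooth (lam \<circ> \<xi>)"
    and "\<And>x. h (\<xi> x) \<noteq> 0" and "\<And>x. \<phi> (\<xi> x) \<noteq> 0"
  defines "g_bar \<equiv> conformal_metric (\<phi> \<circ> \<xi>) (pseudo_euclidean_metric \<epsilon>)"
  assumes "\<And>x. ricci g_bar x - (m / h (\<xi> x)) *\<^sub>R hessian g_bar (h \<circ> \<xi>) x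
                 = lam (\<xi> x) *\<^sub>R g_bar x"
  shows "(\<phi> \<circ> \<xi>) constant_on UNIV \<or> (h \<circ> \<xi>) constant_on UNIV"
proof -
  let ?F = "h \<circ> \<xi>" and ?P = "\<phi> \<circ> \<xi>" and ?c = "real CARD('n) - 2"
  note sign = assms(3)
  note F = smooth_differentiable[OF assms(5)] and P = smooth_differentiable[OF assms(6)]
  have eq: "?c * (partial j (partial j ?P) x / ?P x)
      = m / ?F x * (partial j (partial j ?F) x + 2 * (partial j ?P x / ?P x) * partial j ?F x)" for j x
    using assms(8,9) assms(11)[of x] unfolding g_bar_def
    by (intro conformal_equation_diagonal[OF sign _ P, where n = "Max UNIV" and l = "lam (\<xi> x)"])
       (auto simp: \<xi>_def partial_Max_partial_square_sum)
  have less_Max: "i < Max UNIV \<longleftrightarrow> i \<noteq> Max UNIV" for i :: 'n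
    by (simp add: less_le)
  have axis_const: "h (\<epsilon> i * t\<^sup>2) = h 0" if i: "i < Max UNIV" and "t \<ge> 0" for i t
  proof -
    let ?e = "\<lambda>t. t *\<^sub>R axis i (1 :: real)"
    let ?f = "\<lambda>t. ?F (?e t)" and ?p = "\<lambda>t. ?P (?e t)"
    have \<xi>_axis: "\<xi> (?e t) = \<epsilon> i * t\<^sup>2" for t
      unfolding \<xi>_def by (rule partial_square_sum_axis[OF i])
    have D: "((\<lambda>t. G (?e t)) has_real_derivative partial i G (?e t)) (at t)"
      if "G differentiable_on UNIV" for G t
      using has_real_derivative_partial[OF that, of 0] by simp
    note f = D[OF F(1)] D[OF F(2)] and p = D[OF P(1)] D[OF P(2)]
    \<comment> \<open>On the axis \<open>\<xi>\<close> depends on \<open>t^2\<close> only, so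
      \<open>?f\<close> is even and its derivative vanishes at 0.\<close>
    have mirror: "((\<lambda>t. ?f (- t)) has_real_derivative - partial i ?F (?e 0)) (at 0)"
      using DERIV_mirror[of ?f "partial i ?F (?e 0)" 0] f(1)[of 0] by simp
    have "(\<lambda>t. ?f (- t)) = ?f"
      by (rule ext) (simp only: o_apply \<xi>_axis power2_minus)
    then have "- partial i ?F (?e 0) = partial i ?F (?e 0)"
      using mirror by (intro DERIV_unique[OF _ f(1)[of 0]]) (simp only:)
    then have even: "partial i ?F (?e 0) = 0"
      by linarith
    have "?f t = ?f 0"
    \<comment> \<open>\<open>eq\<close> with \<open>j = i\<close> supplies the axial equation; the
      transverse one is proved below.\<close>
    proof (rule warped_ode_constant[OF f p _ _ \<open>m > 0\<close> _ even eq _ \<open>t \<ge> 0\<close>])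
      fix t :: real assume "t > 0" "?c \<noteq> 0"
      have "\<not> UNIV \<subseteq> {i, Max UNIV}"
      proof
        assume "UNIV \<subseteq> {i, Max UNIV}"
        then have "CARD('n) \<le> card {i, Max UNIV}"
          by (intro card_mono) auto
        with i \<open>?c \<noteq> 0\<close> assms(1) show False by simp
      qed
      then obtain j where j: "j \<noteq> i" "j < Max UNIV"
        by (auto simp: less_Max)
      \<comment> \<open>The quotient of the two signs, so that \<open>\<epsilon> i * t^2 +
        \<epsilon> j * s^2 = \<epsilon> i * (t^2 + \<sigma> * s^2)\<close>.\<close>
      define \<sigma> where "\<sigma> = \<epsilon> i * \<epsilon> j"
      have \<sigma>: "\<sigma> = 1 \<or> \<sigma> = -1" "\<epsilon> i * \<sigma> = \<epsilon> j"
        using sign[of i] sign[of j] by (auto simp: \<sigma>_def)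
      have \<xi>_eq: "\<xi> (?e t + s *\<^sub>R axis j 1) = \<xi> (?e (sqrt (t\<^sup>2 + \<sigma> * s\<^sup>2)))" if "\<bar>s\<bar> < t" for s
      proof -
        have "s\<^sup>2 \<le> t\<^sup>2"
          using that by (simp add: abs_le_square_iff[symmetric])
        then have "t\<^sup>2 + \<sigma> * s\<^sup>2 \<ge> 0"
          using \<sigma>(1) by auto
        moreover have "\<xi> (?e t + s *\<^sub>R axis j 1) = \<epsilon> i * t\<^sup>2 + \<epsilon> j * s\<^sup>2"
          unfolding \<xi>_def using i j by (intro partial_square_sum_axes) auto
        ultimately show ?thesis
          by (simp add: \<xi>_axis algebra_simps flip: \<sigma>(2))
      qed
      have "partial j ?F (?e t) = 0" "partial j (partial j ?F) (?e t) = \<sigma> * (partial i ?F (?e t) / t)"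
        using partial_transverse[OF F(1) f(1) f(2) \<sigma>(1) \<open>t > 0\<close>, of "?e t" j] \<xi>_eq by simp_all
      moreover have "partial j (partial j ?P) (?e t) = \<sigma> * (partial i ?P (?e t) / t)"
        using partial_transverse[OF P(1) p(1) p(2) \<sigma>(1) \<open>t > 0\<close>, of "?e t" j] \<xi>_eq by simp
      \<comment> \<open>The mixed first-order term vanishes with \<open>partial j ?F\<close>, and
        \<open>\<sigma>\<close> cancels from both sides.\<close>
      ultimately show "?c * (partial i ?P (?e t) / t / ?p t) = m / ?f t * (partial i ?F (?e t) / t)"
        using eq[of j "?e t"] \<sigma>(1) by auto
    qed (use assms in auto)
    then show ?thesis
      by (simp only: o_apply \<xi>_axis) simp
  qed
  \<comment> \<open>Every nonzero value of \<open>\<xi>\<close> has the sign of some \<open>\<epsilon> i\<close>, so it is attained on the \<open>i\<close>-th axis.\<close>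
  have "?F x = h 0" for x
  proof (cases "\<xi> x = 0")
    case False
    have "\<exists>i<Max UNIV. \<epsilon> i * \<xi> x > 0"
    proof (rule ccontr)
      assume "\<not> ?thesis"
      then have "\<epsilon> i * \<xi> x \<le> 0" if "i < Max UNIV" for i
        using that by force
      then have "(\<Sum>k | k < Max UNIV. \<epsilon> k * \<xi> x * (x $ k)\<^sup>2) \<le> 0"
        by (intro sum_nonpos) (simp add: mult_nonpos_nonneg)
      \<comment> \<open>Were no sign suitable, \<open>\<xi> x * \<xi> x\<close> would be a sum of
        nonpositive terms.\<close>
      moreover have "(\<Sum>k | k < Max UNIV. \<epsilon> k * \<xi> x * (x $ k)\<^sup>2) = \<xi> x * \<xi> x"
        by (subst (3) \<xi>_def) (simp add: partial_square_sum_def sum_distrib_left mult_ac)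
      ultimately show False
        using False not_square_less_zero[of "\<xi> x"] by (simp add: order_le_less)
    qed
    then obtain i where i: "i < Max UNIV" "\<epsilon> i * \<xi> x > 0" by blast
    then have "\<epsilon> i * (sqrt (\<epsilon> i * \<xi> x))\<^sup>2 = \<xi> x"
      using sign[of i] by auto
    moreover have "h (\<epsilon> i * (sqrt (\<epsilon> i * \<xi> x))\<^sup>2) = h 0"
      using i by (intro axis_const) auto
    ultimately show ?thesis by (simp only: o_apply)
  qed simp
  then show ?thesis
    by (auto simp: constant_on_def)
qed

end
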